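(* Let $H$ be a non negative measurable functional on $(\mathbb{R}^d)^{\mathbb{Z}}$. Then, for all $k\in\mathbb{Z}$ and $t>0$, $$\mathbb{E}\left[H(B^k\boldsymbol Y)\mathbf{1}\{|\boldsymbol Y_{-k}|>t\}\right]=t^{-\alpha}\,\mathbb{E}\left[H(t\boldsymbol Y)\mathbf{1}\{|\boldsymbol Y_k|>1/t\}\right].$$
   Context: Let $|\cdot|$ be an arbitrary norm on $\mathbb{R}^d$. Let $\{\boldsymbol X_j,j\in\mathbb{Z}\}$ be a stationary $\mathbb{R}^d$-valued time series which is regularly varying: for all integers $s\le t$ there is a non-zero Radon measure $\nu_{s,t}$ on $(\mathbb{R}^d)^{[s,t]}\setminus\{\boldsymbol 0\}$ such that $\mathbb{P}(u^{-1}(\boldsymbol X_s,\dots,\boldsymbol X_t)\in\cdot)/\mathbb{P}(|\boldsymbol X_0|>u)\to\nu_{s,t}$ vaguely as $u\to\infty$. Let $\alpha>0$ be its tail index. The tail process is the random sequence $\boldsymbol Y=\{\boldsymbol Y_j,j\in\mathbb{Z}\}$ with $\mathbb{P}(|\boldsymbol Y_0|>y)=y^{-\alpha}$ for $y\ge1$ and such that, for all $s\le t$, the law of $u^{-1}(\boldsymbol X_s,\dots,\boldsymbol X_t)$ conditionally on $|\boldsymbol X_0|>u$ converges weakly to that of $(\boldsymbol Y_s,\dots,\boldsymbol Y_t)$ as $u\to\infty$. The tail measure $\nu$ is the unique Borel measure on $(\mathbb{R}^d)^{\mathbb{Z}}$ (product topology) with $\nu(\{\boldsymbol 0\})=0$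 and $\nu\circ p_{s,t}^{-1}=\nu_{s,t}$ on $(\mathbb{R}^d)^{[s,t]}\setminus\{\boldsymbol 0\}$ for all $s\le t$, where $p_{s,t}$ is the canonical projection. It is known that $\nu$ is $\sigma$-finite, shift invariant, satisfies $\nu(c\,\cdot)=c^{-\alpha}\nu$ for all $c>0$, and $\mathbb{E}[H(\boldsymbol Y)]=\int H(\boldsymbol y)\mathbf{1}\{|\boldsymbol y_0|>1\}\,\nu(\mathrm{d}\boldsymbol y)$ for every non negative measurable $H$. Notation: $B$ is the backshift, $(B\boldsymbol x)_j=\boldsymbol x_{j-1}$, and $B^k$, $k\in\mathbb{Z}$, its iterates. *)

theory Defs
  imports "HOL-Probability.Probability"
begin

definition is_norm :: "('v::real_vector \<Rightarrow> real) \<Rightarrow> bool" where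
  "is_norm N \<longleftrightarrow>
     (\<forall>x. N x \<ge> 0) \<and> (\<forall>x. N x = 0 \<longleftrightarrow> x = 0) \<and>
     (\<forall>c x. N (c *\<^sub>R x) = \<bar>c\<bar> * N x) \<and>
     (\<forall>x y. N (x + y) \<le> N x + N y)"

definition backshift :: "(int \<Rightarrow> 'v) \<Rightarrow> int \<Rightarrow> 'v" where
  "backshift x = (\<lambda>j. x (j - 1))"

definition backshift_pow :: "int \<Rightarrow> (int \<Rightarrow> 'v) \<Rightarrow> int \<Rightarrow> 'v" where
  "backshift_pow k =
     (if k \<ge> 0 then backshift ^^ nat k else inv backshift ^^ nat (- k))"

lemma backshift_pow_apply: "backshift_pow k x j = x (j - k)"
proof -
  have inv: "inv backshift = (\<lambda>(x::int \<Rightarrow> 'a) j. x (j + 1))"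
    by (rule inv_equality) (auto simp: backshift_def)
  have pos: "(backshift ^^ n) x j = x (j - int n)" for n and x :: "int \<Rightarrow> 'a" and j
    by (induction n arbitrary: j) (auto simp: backshift_def algebra_simps)
  have neg: "(inv backshift ^^ n) x j = x (j + int n)" for n and x :: "int \<Rightarrow> 'a" and j
    unfolding inv by (induction n arbitrary: j) (auto simp: algebra_simps)
  show ?thesis
    by (auto simp: backshift_pow_def pos neg)
qed

definition stationary :: "'a measure \<Rightarrow> (int \<Rightarrow> 'a \<Rightarrow> 'v::topological_space) \<Rightarrow> bool" where
  "stationary M X \<longleftrightarrow>
     (\<forall>h. distr M borel (\<lambda>\<omega> j. X (j + h) \<omega>) = distr M borel (\<lambda>\<omega> j. X j \<omega>))"

text \<open>The library has weak convergence only for measures on the real line, and no vague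
  convergence.\<close>

definition converges_weakly ::
    "'s topology \<Rightarrow> ('i \<Rightarrow> 's measure) \<Rightarrow> 's measure \<Rightarrow> 'i filter \<Rightarrow> bool" where
  "converges_weakly T \<mu> \<mu>\<^sub>0 F \<longleftrightarrow>
     (\<forall>f. continuous_map T euclideanreal f \<and> bounded (f ` topspace T) \<longrightarrow>
        ((\<lambda>i. \<integral>x. f x \<partial>\<mu> i) \<longlongrightarrow> (\<integral>x. f x \<partial>\<mu>\<^sub>0)) F)"

definition converges_vaguely ::
    "'s topology \<Rightarrow> ('i \<Rightarrow> 's measure) \<Rightarrow> 's measure \<Rightarrow> 'i filter \<Rightarrow> bool" where
  "converges_vaguely T \<mu> \<mu>\<^sub>0 F \<longleftrightarrow>
     (\<forall>f. continuous_map T euclideanreal f \<and>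
          (\<exists>K. compactin T K \<and> (\<forall>x \<in> topspace T - K. f x = 0)) \<longrightarrow>
        ((\<lambda>i. \<integral>x. f x \<partial>\<mu> i) \<longlongrightarrow> (\<integral>x. f x \<partial>\<mu>\<^sub>0)) F)"

text \<open>On the locally compact, second countable spaces considered here, a Borel measure that is
  finite on compact sets is automatically regular.\<close>

definition radon_measure :: "'s topology \<Rightarrow> 's measure \<Rightarrow> bool" where
  "radon_measure T \<mu> \<longleftrightarrow>
     sets \<mu> = sigma_sets (topspace T) {U. openin T U} \<and>
     (\<forall>K. compactin T K \<longrightarrow> emeasure \<mu> K < \<infinity>)"

text \<open>The space of windows indexed by \<open>[s,t]\<close> is the space of extensional functions on
  \<open>{s..t}\<close>; its origin is \<open>\<lambda>j\<in>{s..t}. 0\<close>.\<close>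

definition window_space :: "int \<Rightarrow> int \<Rightarrow> (int \<Rightarrow> 'v::topological_space) topology" where
  "window_space s t = product_topology (\<lambda>_. euclidean) {s..t}"

definition punctured_window_space ::
    "int \<Rightarrow> int \<Rightarrow> (int \<Rightarrow> 'v::{topological_space, zero}) topology" where
  "punctured_window_space s t =
     subtopology (window_space s t) (topspace (window_space s t) - {\<lambda>j\<in>{s..t}. 0})"

definition window_law ::
    "'a measure \<Rightarrow> (int \<Rightarrow> 'a \<Rightarrow> 'v::topological_space) \<Rightarrow> int \<Rightarrow> int \<Rightarrow> (int \<Rightarrow> 'v) measure" where
  "window_law M X s t =
     distr M (Pi\<^sub>M {s..t} (\<lambda>_. borel)) (\<lambda>\<omega>. \<lambda>j\<in>{s..t}. X j \<omega>)"

definition tail_event ::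
    "('v \<Rightarrow> real) \<Rightarrow> 'a measure \<Rightarrow> (int \<Rightarrow> 'a \<Rightarrow> 'v) \<Rightarrow> real \<Rightarrow> 'a set" where
  "tail_event N M X u = {\<omega> \<in> space M. N (X 0 \<omega>) > u}"

text \<open>\<open>is_window_limit N M X s t \<nu>\<close> says that \<open>\<nu>\<close> is the measure \<open>\<nu>\<^sub>s\<^sub>,\<^sub>t\<close> in the
  definition of regular variation. If the denominator vanished for some \<open>u\<close>, it would vanish
  for all larger ones, and the limit would be the zero measure; so the convention
  \<open>1 / 0 = 0\<close> never comes into play.\<close>

definition is_window_limit ::
    "('v::real_normed_vector \<Rightarrow> real) \<Rightarrow> 'a measure \<Rightarrow> (int \<Rightarrow> 'a \<Rightarrow> 'v) \<Rightarrow>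
      int \<Rightarrow> int \<Rightarrow> (int \<Rightarrow> 'v) measure \<Rightarrow> bool" where
  "is_window_limit N M X s t \<nu> \<longleftrightarrow>
     radon_measure (punctured_window_space s t) \<nu> \<and>
     emeasure \<nu> (space \<nu>) \<noteq> 0 \<and>
     converges_vaguely (punctured_window_space s t)
       (\<lambda>u. scale_measure (ennreal (1 / measure M (tail_event N M X u)))
              (restrict_space (window_law M (\<lambda>j \<omega>. inverse u *\<^sub>R X j \<omega>) s t)
                 (topspace (punctured_window_space s t))))
       \<nu> at_top"

definition regularly_varying ::
    "('v::real_normed_vector \<Rightarrow> real) \<Rightarrow> 'a measure \<Rightarrow> (int \<Rightarrow> 'a \<Rightarrow> 'v) \<Rightarrow> bool" where
  "regularly_varying N M X \<longleftrightarrow>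
     (\<forall>s t. s \<le> t \<longrightarrow> (\<exists>\<nu>. is_window_limit N M X s t \<nu>))"

text \<open>The tail index is the degree of homogeneity of the limit measures.\<close>

definition tail_index ::
    "('v::real_normed_vector \<Rightarrow> real) \<Rightarrow> 'a measure \<Rightarrow> (int \<Rightarrow> 'a \<Rightarrow> 'v) \<Rightarrow> real \<Rightarrow> bool" where
  "tail_index N M X \<alpha> \<longleftrightarrow>
     \<alpha> > 0 \<and>
     (\<forall>s t \<nu>. s \<le> t \<and> is_window_limit N M X s t \<nu> \<longrightarrow>
        (\<forall>c > 0. \<forall>A \<in> sets \<nu>.
           emeasure \<nu> ((\<lambda>x. \<lambda>j\<in>{s..t}. c *\<^sub>R x j) ` A) = ennreal (c powr - \<alpha>) * emeasure \<nu> A))"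

text \<open>The tail process may live on a probability space \<open>M'\<close> of its own; only its law is
  determined. Conditioning on an event is \<^const>\<open>uniform_measure\<close>.\<close>

definition tail_process ::
    "('v::real_normed_vector \<Rightarrow> real) \<Rightarrow> 'a measure \<Rightarrow> (int \<Rightarrow> 'a \<Rightarrow> 'v) \<Rightarrow> real \<Rightarrow>
      'b measure \<Rightarrow> (int \<Rightarrow> 'b \<Rightarrow> 'v) \<Rightarrow> bool" where
  "tail_process N M X \<alpha> M' Y \<longleftrightarrow>
     prob_space M' \<and> (\<forall>j. Y j \<in> borel_measurable M') \<and>
     (\<forall>y \<ge> 1. measure M' {\<omega> \<in> space M'. N (Y 0 \<omega>) > y} = y powr - \<alpha>) \<and>
     (\<forall>s t. s \<le> t \<longrightarrow>
        converges_weakly (window_space s t)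
          (\<lambda>u. window_law (uniform_measure M (tail_event N M X u))
                 (\<lambda>j \<omega>. inverse u *\<^sub>R X j \<omega>) s t)
          (window_law M' Y s t) at_top)"

end

theory Submission
  imports Defs
begin

text \<open>Stationarity is an exact symmetry before the limit, and the identity is what remains of it
  after the limit. Let \<open>g\<close> be a function that vanishes unless \<open>N (x 0) > t\<close> and \<open>N (x k) > 1\<close>.
  Then in \<open>g (B\<^sup>k X / u)\<close> the condition \<open>N (X 0) > u\<close> is implied by \<open>g \<noteq> 0\<close>; after a shift by
  \<open>k\<close> the same expression reads \<open>g (X / u)\<close>, and there \<open>N (X 0) > t u\<close> is implied instead.
  So the integral of \<open>g (B\<^sup>k X / u)\<close> over the event \<open>N (X 0) > u\<close> equals the integral of
  \<open>g (t X / (t u))\<close> over the event \<open>N (X 0) > t u\<close> (\<open>tail_integral_time_change\<close>).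
  Dividing by \<open>P(N (X 0) > u)\<close> and letting \<open>u \<rightarrow> \<infinity>\<close>, the two sides converge to
  \<open>E g (B\<^sup>k Y)\<close> and \<open>c E g (t Y)\<close>, where \<open>c\<close> is the limit of
  \<open>P(N (X 0) > t u) / P(N (X 0) > u)\<close>.

  That this limit exists and equals \<open>t\<^sup>-\<^sup>\<alpha>\<close> follows from the same symmetry with \<open>k = 0\<close>, by testing
  it on functions that increase to the indicator of an event whose probability is known from the
  Pareto law of \<open>N (Y 0)\<close> (\<open>tail_prob_ratio\<close>).

  Two approximations turn the limit into a statement about laws. Weak convergence only controls
  functions of finitely many coordinates, so a continuous function of the whole path is
  precomposed with truncation to a growing window (\<open>time_change_continuous\<close>). Indicators of open
  sets are then limits of continuous functions vanishing off the set (\<open>time_change_open\<close>); since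
  both indicators in the claim define open sets, working with continuous functions that vanish off
  these sets avoids any question of atoms on their boundaries. Open sets generate the Borel sets,
  which gives equality of two finite measures (\<open>time_change_law\<close>) and hence the claim for every
  \<open>H\<close>: of the two conditions on \<open>g\<close>, one becomes the indicator in the claim, and the other becomes
  \<open>N (Y 0) > 1\<close>, which holds almost surely.\<close>

section \<open>Continuous functions on path space\<close>

text \<open>A norm is convex, and convex functions on a Euclidean space are continuous.\<close>

lemma is_norm_continuous_on:
  fixes N :: "'v::euclidean_space \<Rightarrow> real"
  assumes "is_norm N"
  shows "continuous_on S N"
proof -
  have "convex_on UNIV N"
  proof (rule convex_onI)
    fix t :: real and x y
    assume t: "0 < t" "t < 1"
    have "N ((1 - t) *\<^sub>R x + t *\<^sub>R y) \<le> N ((1 - t) *\<^sub>R x) + N (t *\<^sub>R y)"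
      using assms unfolding is_norm_def by blast
    also have "\<dots> = (1 - t) * N x + t * N y"
      using assms t unfolding is_norm_def by simp
    finally show "N ((1 - t) *\<^sub>R x + t *\<^sub>R y) \<le> (1 - t) * N x + t * N y" .
  qed simp
  then show ?thesis
    using convex_on_continuous[OF open_UNIV] continuous_on_subset by blast
qed

text \<open>The approximants \<open>min 1 (n * d(x, - A))\<close> vanish off \<open>A\<close>, so any support condition satisfied
  by the indicator of \<open>A\<close> is inherited by them. Since \<^const>\<open>infdist\<close> to the empty set is \<open>0\<close>,
  the whole space is treated apart.\<close>

lemma open_indicator_continuous_limit:
  fixes A :: "'s::metric_space set"
  assumes "open A"
  obtains g :: "nat \<Rightarrow> 's \<Rightarrow> real" where
    "\<And>n. continuous_on UNIV (g n)" "\<And>n x. 0 \<le> g n x" "\<And>n x. g n x \<le> 1"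
    "\<And>n x. x \<notin> A \<Longrightarrow> g n x = 0" "\<And>x. (\<lambda>n. g n x) \<longlonglongrightarrow> indicator A x"
proof (cases "A = UNIV")
  case True
  show ?thesis
    by (rule that[of "\<lambda>_ _. 1"]) (auto simp: True)
next
  case False
  define g :: "nat \<Rightarrow> 's \<Rightarrow> real" where "g n x = min 1 (real n * infdist x (- A))" for n x
  have lim: "(\<lambda>n. g n x) \<longlonglongrightarrow> indicator A x" for x
  proof (cases "x \<in> A")
    case True
    then have pos: "infdist x (- A) > 0"
      using assms False by (intro infdist_pos_not_in_closed) auto
    obtain n0 :: nat where n0: "1 / infdist x (- A) \<le> real n0"
      using real_arch_simple by blast
    have "g n x = 1" if "n \<ge> n0" for n
    proof -
      have "1 \<le> real n0 * infdist x (- A)"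
        using n0 pos by (simp add: field_simps)
      also have "\<dots> \<le> real n * infdist x (- A)"
        using that pos by (intro mult_right_mono) auto
      finally show ?thesis by (simp add: g_def)
    qed
    then have "eventually (\<lambda>n. g n x = 1) sequentially"
      by (auto simp: eventually_sequentially)
    then show ?thesis
      using True by (simp add: tendsto_eventually)
  qed (simp add: g_def)
  have "continuous_on UNIV (g n)" for n
    unfolding g_def by (intro continuous_intros)
  moreover have "0 \<le> g n x" for n x
    unfolding g_def using infdist_nonneg[of x "- A"] by simp
  moreover have "g n x \<le> 1" "x \<notin> A \<Longrightarrow> g n x = 0" for n x
    by (simp_all add: g_def)
  ultimately show ?thesis
    using lim by (rule that)
qed

text \<open>Truncation stays inside the space of all paths, unlike restriction to a window. A continuous
  function of paths that is invariant under it is the same thing as a continuous function of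
  a window, and windows can be varied without changing types or domains.\<close>

definition truncation :: "nat \<Rightarrow> (int \<Rightarrow> 'v::zero) \<Rightarrow> int \<Rightarrow> 'v" where
  "truncation m x = (\<lambda>j. if \<bar>j\<bar> \<le> int m then x j else 0)"

lemma continuous_on_truncation:
  "continuous_on S (truncation m :: (int \<Rightarrow> 'v::{zero, topological_space}) \<Rightarrow> _)"
proof (rule continuous_on_coordinatewise_then_product)
  fix j
  have "continuous_on S (\<lambda>x :: int \<Rightarrow> 'v. x j)"
    by (rule continuous_on_subset[OF continuous_on_product_coordinates subset_UNIV])
  then show "continuous_on S (\<lambda>x :: int \<Rightarrow> 'v. truncation m x j)"
    by (cases "\<bar>j\<bar> \<le> int m") (simp_all add: truncation_def)
qed

text \<open>Each coordinate is eventually constant in \<open>m\<close>.\<close>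

lemma truncation_tendsto:
  fixes x :: "int \<Rightarrow> 'v::{zero, topological_space}"
  shows "(\<lambda>m. truncation m x) \<longlonglongrightarrow> x"
proof -
  have "(\<lambda>m. truncation m x j) \<longlonglongrightarrow> x j" for j
  proof (rule tendsto_eventually)
    show "eventually (\<lambda>m. truncation m x j = x j) sequentially"
      using eventually_ge_at_top[of "nat \<bar>j\<bar>"]
      by eventually_elim (auto simp: truncation_def)
  qed
  then have "limitin (product_topology (\<lambda>_. euclidean) UNIV) (\<lambda>m. truncation m x) x sequentially"
    unfolding limitin_componentwise by auto
  then show ?thesis
    by (simp add: euclidean_product_topology)
qed

lemma continuous_on_scale_path:
  "continuous_on UNIV (\<lambda>(x :: int \<Rightarrow> 'v::real_normed_vector) j. c *\<^sub>R x j)"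
  by (intro continuous_on_coordinatewise_then_product continuous_on_scaleR continuous_on_const
      continuous_on_product_coordinates)

lemma continuous_on_backshift_pow:
  "continuous_on UNIV (backshift_pow k :: (int \<Rightarrow> 'v::topological_space) \<Rightarrow> _)"
  by (intro continuous_on_coordinatewise_then_product)
    (simp add: backshift_pow_apply)

section \<open>The setting, and conditional means\<close>

lemma integral_uniform_measure:
  fixes f :: "'s \<Rightarrow> real"
  assumes "finite_measure M" and [measurable]: "A \<in> sets M" "f \<in> borel_measurable M"
    and pos: "measure M A > 0"
  shows "(\<integral>x. f x \<partial>uniform_measure M A) = (\<integral>x. f x * indicator A x \<partial>M) / measure M A"
proof -
  interpret finite_measure M by fact
  have "uniform_measure M A = density M (\<lambda>x. ennreal (indicator A x / measure M A))"
    unfolding uniform_measure_def using pos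
    by (intro arg_cong2[where f=density])
      (auto simp: emeasure_eq_measure divide_ennreal[symmetric] ennreal_indicator)
  then have "(\<integral>x. f x \<partial>uniform_measure M A)
      = (\<integral>x. (f x * indicator A x) / measure M A \<partial>M)"
    using pos by (simp add: integral_density mult.commute)
  then show ?thesis by simp
qed

lemma (in prob_space) expectation_tendsto_bounded:
  fixes f :: "nat \<Rightarrow> 'a \<Rightarrow> real"
  assumes "\<And>n. f n \<in> borel_measurable M" "g \<in> borel_measurable M"
    and "\<And>\<omega>. (\<lambda>n. f n \<omega>) \<longlonglongrightarrow> g \<omega>" and "\<And>n \<omega>. \<bar>f n \<omega>\<bar> \<le> C"
  shows "(\<lambda>n. expectation (f n)) \<longlonglongrightarrow> expectation g"
  using assms by (intro integral_dominated_convergence[where w = "\<lambda>_. C"]) auto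

locale stationary_tail_process =
  fixes N :: "'v::euclidean_space \<Rightarrow> real"
    and M :: "'a measure" and X :: "int \<Rightarrow> 'a \<Rightarrow> 'v"
    and M' :: "'b measure" and Y :: "int \<Rightarrow> 'b \<Rightarrow> 'v" and \<alpha> :: real
  assumes norm: "is_norm N" and prob_M: "prob_space M"
    and X_measurable [measurable]: "\<And>j. X j \<in> borel_measurable M"
    and stat: "stationary M X"
    and tail: "tail_process N M X \<alpha> M' Y"
begin

sublocale M: prob_space M by (rule prob_M)

sublocale M': prob_space M'
  using tail unfolding tail_process_def by blast

lemma Y_measurable [measurable]: "Y j \<in> borel_measurable M'"
  using tail unfolding tail_process_def by blast

lemma N_continuous: "continuous_on S N"
  by (rule is_norm_continuous_on[OF norm])

lemma N_measurable [measurable]: "N \<in> borel_measurable borel"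
  by (rule borel_measurable_continuous_onI[OF N_continuous])

lemma N_scale: "c > 0 \<Longrightarrow> N (c *\<^sub>R x) = c * N x"
  using norm unfolding is_norm_def by simp

lemma open_coordinate_exceeds: "open {x :: int \<Rightarrow> 'v. N (x j) > s}"
proof -
  have "continuous_on UNIV (\<lambda>x :: int \<Rightarrow> 'v. N (x j))"
    by (rule continuous_on_compose2[OF N_continuous[of UNIV] continuous_on_product_coordinates]) simp
  then show ?thesis
    by (intro open_Collect_less continuous_on_const)
qed

lemma Y_exceeds: "s \<ge> 1 \<Longrightarrow> measure M' {\<omega> \<in> space M'. N (Y 0 \<omega>) > s} = s powr - \<alpha>"
  using tail unfolding tail_process_def by blast

lemma AE_Y_exceeds: "AE \<omega> in M'. N (Y 0 \<omega>) > 1"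
  using M'.AE_prob_1[OF Y_exceeds[of 1, simplified]]
  by eventually_elim simp

lemma X_path_measurable [measurable]: "(\<lambda>\<omega> j. c *\<^sub>R X j \<omega>) \<in> borel_measurable M"
  by (intro measurable_coordinatewise_then_product) measurable

lemma Y_path_measurable [measurable]: "(\<lambda>\<omega> j. c *\<^sub>R Y j \<omega>) \<in> borel_measurable M'"
  by (intro measurable_coordinatewise_then_product) measurable

lemma Y_path_measurable' [measurable]: "(\<lambda>\<omega> j. Y j \<omega>) \<in> borel_measurable M'"
  by (intro measurable_coordinatewise_then_product) measurable

definition tail_prob :: "real \<Rightarrow> real" where
  "tail_prob u = measure M (tail_event N M X u)"

text \<open>Normalised by \<open>tail_prob u\<close>, this is the conditional expectation of \<open>g (X / u)\<close> given that
  \<open>N (X 0) > u\<close>. The unnormalised form is the one in which stationarity is an exact identity.\<close>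

definition tail_integral :: "((int \<Rightarrow> 'v) \<Rightarrow> real) \<Rightarrow> real \<Rightarrow> real" where
  "tail_integral g u = (\<integral>\<omega>. g (\<lambda>j. inverse u *\<^sub>R X j \<omega>) * indicator (tail_event N M X u) \<omega> \<partial>M)"

lemma tail_event_sets [measurable]: "tail_event N M X u \<in> sets M"
  unfolding tail_event_def by measurable

text \<open>If some tail probability were zero, all later ones would be too, and conditioning on a null
  event yields the zero measure. The total masses of the window laws would then converge to \<open>0\<close>,
  although weak convergence sends them to the total mass \<open>1\<close> of the law of \<open>Y 0\<close>.\<close>

lemma tail_prob_pos: "tail_prob u > 0"
proof (rule ccontr)
  assume "\<not> tail_prob u > 0"
  then have zero: "tail_prob u = 0"
    by (simp add: tail_prob_def zero_less_measure_iff)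
  have "uniform_measure M (tail_event N M X v) = density M (\<lambda>_. 0)" if "v \<ge> u" for v
  proof -
    have "tail_prob v \<le> tail_prob u"
      unfolding tail_prob_def using that
      by (intro M.finite_measure_mono) (auto simp: tail_event_def)
    with zero have "emeasure M (tail_event N M X v) = 0"
      by (simp add: tail_prob_def M.emeasure_eq_measure zero_less_measure_iff measure_le_0_iff)
    then have "AE \<omega> in M. \<omega> \<notin> tail_event N M X v"
      by (intro AE_not_in) (auto simp: null_sets_def)
    then show ?thesis
      unfolding uniform_measure_def
      by (intro density_cong) (auto elim!: eventually_mono)
  qed
  then have "(\<integral>x. 1 \<partial>window_law (uniform_measure M (tail_event N M X v))
      (\<lambda>j \<omega>. inverse v *\<^sub>R X j \<omega>) 0 0) = (0::real)" if "v \<ge> u" for v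
    unfolding window_law_def using that
    by (subst integral_distr) (auto simp: integral_density measure_def emeasure_density)
  then have "((\<lambda>v. \<integral>x. 1 \<partial>window_law (uniform_measure M (tail_event N M X v))
      (\<lambda>j \<omega>. inverse v *\<^sub>R X j \<omega>) 0 0) \<longlongrightarrow> (0::real)) at_top"
    by (intro tendsto_eventually) (auto simp: eventually_at_top_linorder)
  moreover have "((\<lambda>v. \<integral>x. 1 \<partial>window_law (uniform_measure M (tail_event N M X v))
      (\<lambda>j \<omega>. inverse v *\<^sub>R X j \<omega>) 0 0) \<longlongrightarrow> (\<integral>x. (1::real) \<partial>window_law M' Y 0 0)) at_top"
  proof -
    have "converges_weakly (window_space 0 0)
        (\<lambda>v. window_law (uniform_measure M (tail_event N M X v)) (\<lambda>j \<omega>. inverse v *\<^sub>R X j \<omega>) 0 0)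
        (window_law M' Y 0 0) at_top"
      using tail unfolding tail_process_def by simp
    moreover have "bounded ((\<lambda>_. 1::real) ` topspace (window_space 0 0 :: (int \<Rightarrow> 'v) topology))"
      by (rule bounded_subset[of "{1}"]) auto
    ultimately show ?thesis
      unfolding converges_weakly_def
      by (elim allE[of _ "\<lambda>_. 1::real"] impE) (simp_all only: continuous_map_const topspace_euclidean, simp)
  qed
  moreover have "(\<integral>x. (1::real) \<partial>window_law M' Y 0 0) = 1"
    unfolding window_law_def by (subst integral_distr) (simp_all add: M'.prob_space)
  ultimately show False
    by (auto dest: tendsto_unique[OF trivial_limit_at_top_linorder] simp del: integral_const)
qed

text \<open>This restates the weak convergence of the window laws on \<open>{- m..m}\<close> in terms of functions of
  whole paths: padding a window with zeros is a continuous map into path space.\<close>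

lemma tail_integral_limit:
  fixes g :: "(int \<Rightarrow> 'v) \<Rightarrow> real"
  assumes g: "continuous_on UNIV g" and bdd: "bounded (range g)"
    and cyl: "\<And>x. g (truncation m x) = g x"
  shows "((\<lambda>u. tail_integral g u / tail_prob u) \<longlongrightarrow> (\<integral>\<omega>. g (\<lambda>j. Y j \<omega>) \<partial>M')) at_top"
proof -
  let ?I = "{- int m..int m}" and ?T = "window_space (- int m) (int m) :: (int \<Rightarrow> 'v) topology"
  let ?f = "\<lambda>x. g (truncation m x)"
  have [measurable]: "g \<in> borel_measurable borel"
    by (rule borel_measurable_continuous_onI[OF g])
  have restr: "?f (\<lambda>j\<in>?I. x j) = g x" for x
  proof -
    have "truncation m (\<lambda>j\<in>?I. x j) = truncation m x"
      by (auto simp: truncation_def restrict_def abs_le_iff)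
    then show ?thesis by (simp add: cyl)
  qed
  have trunc: "continuous_map ?T euclidean (truncation m)"
    unfolding euclidean_product_topology[symmetric] continuous_map_componentwise_UNIV
  proof
    fix j
    show "continuous_map ?T euclidean (\<lambda>x. truncation m x j)"
    proof (cases "\<bar>j\<bar> \<le> int m")
      case True
      then show ?thesis
        unfolding window_space_def truncation_def
        by (auto intro!: continuous_map_product_projection)
    qed (simp add: truncation_def)
  qed
  have cont: "continuous_map ?T euclideanreal ?f"
    using continuous_map_compose[OF trunc, of euclideanreal g] g by (simp add: o_def)
  have bddf: "bounded (?f ` topspace ?T)"
    using bdd by (rule bounded_subset) auto
  have [measurable]: "(truncation m :: (int \<Rightarrow> 'v) \<Rightarrow> _) \<in> Pi\<^sub>M ?I (\<lambda>_. borel) \<rightarrow>\<^sub>M borel"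
  proof (rule measurable_coordinatewise_then_product)
    fix j
    show "(\<lambda>x. truncation m x j :: 'v) \<in> Pi\<^sub>M ?I (\<lambda>_. borel) \<rightarrow>\<^sub>M borel"
      by (cases "j \<in> ?I") (auto simp: truncation_def intro: measurable_component_singleton)
  qed
  have lim: "((\<lambda>u. \<integral>x. ?f x \<partial>window_law (uniform_measure M (tail_event N M X u))
                 (\<lambda>j \<omega>. inverse u *\<^sub>R X j \<omega>) (- int m) (int m))
      \<longlongrightarrow> (\<integral>x. ?f x \<partial>window_law M' Y (- int m) (int m))) at_top"
  proof -
    have "converges_weakly ?T
          (\<lambda>u. window_law (uniform_measure M (tail_event N M X u))
                 (\<lambda>j \<omega>. inverse u *\<^sub>R X j \<omega>) (- int m) (int m))
          (window_law M' Y (- int m) (int m)) at_top"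
      using tail unfolding tail_process_def by simp
    then show ?thesis
      unfolding converges_weakly_def using cont bddf by blast
  qed
  have meas: "(\<lambda>\<omega>. \<lambda>j\<in>?I. inverse u *\<^sub>R X j \<omega>)
        \<in> uniform_measure M (tail_event N M X u) \<rightarrow>\<^sub>M Pi\<^sub>M ?I (\<lambda>_. borel)"
      "(\<lambda>\<omega>. \<lambda>j\<in>?I. Y j \<omega>) \<in> M' \<rightarrow>\<^sub>M Pi\<^sub>M ?I (\<lambda>_. borel)"
      "?f \<in> Pi\<^sub>M ?I (\<lambda>_. borel) \<rightarrow>\<^sub>M borel" for u
    by measurable
  have "(\<integral>x. ?f x \<partial>window_law (uniform_measure M (tail_event N M X u))
                 (\<lambda>j \<omega>. inverse u *\<^sub>R X j \<omega>) (- int m) (int m)) = tail_integral g u / tail_prob u" for u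
  proof -
    have "(\<integral>x. ?f x \<partial>window_law (uniform_measure M (tail_event N M X u))
                 (\<lambda>j \<omega>. inverse u *\<^sub>R X j \<omega>) (- int m) (int m))
        = (\<integral>\<omega>. g (\<lambda>j. inverse u *\<^sub>R X j \<omega>) \<partial>uniform_measure M (tail_event N M X u))"
      unfolding window_law_def by (subst integral_distr) (auto simp only: restr intro!: meas)
    also have "\<dots> = tail_integral g u / tail_prob u"
      unfolding tail_integral_def tail_prob_def
      using tail_prob_pos[of u] unfolding tail_prob_def
      by (intro integral_uniform_measure) (auto intro: M.finite_measure_axioms)
    finally show ?thesis .
  qed
  moreover have "(\<integral>x. ?f x \<partial>window_law M' Y (- int m) (int m)) = (\<integral>\<omega>. g (\<lambda>j. Y j \<omega>) \<partial>M')"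
    unfolding window_law_def by (subst integral_distr) (auto simp only: restr intro!: meas)
  ultimately show ?thesis
    using lim by simp
qed

section \<open>Time change before the limit\<close>

text \<open>Up to scale, both indicators in the claim: with \<open>x = B\<^sup>k Y\<close> the two conditions are
  \<open>N (Y (- k)) > t\<close> and \<open>N (Y 0) > 1\<close>, and with \<open>x = t Y\<close> they are \<open>N (Y 0) > 1\<close> and
  \<open>N (Y k) > 1 / t\<close>.\<close>

definition exceedances :: "real \<Rightarrow> int \<Rightarrow> (int \<Rightarrow> 'v) set" where
  "exceedances t k = {x. N (x 0) > t} \<inter> {x. N (x k) > 1}"

lemma open_exceedances: "open (exceedances t k)"
  unfolding exceedances_def by (intro open_Int open_coordinate_exceeds)

text \<open>Both sides are equal to an integral without conditioning. On the left the shifted path has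
  \<open>X 0\<close> at position \<open>k\<close>, so the support condition at \<open>k\<close> makes the conditioning event redundant;
  on the right the support condition at \<open>0\<close> does. Stationarity equates what is left.\<close>

lemma tail_integral_time_change:
  fixes g :: "(int \<Rightarrow> 'v) \<Rightarrow> real"
  assumes [measurable]: "g \<in> borel_measurable borel"
    and supp: "\<And>x. x \<notin> exceedances t k \<Longrightarrow> g x = 0"
    and t: "t > 0" and u: "u > 0"
  shows "tail_integral (g \<circ> backshift_pow k) u
       = tail_integral (\<lambda>x. g (\<lambda>j. t *\<^sub>R x j)) (t * u)"
proof -
  have scl: "N (inverse u *\<^sub>R x) = N x / u" for x
    using u by (simp add: N_scale divide_inverse mult.commute)
  have [measurable]: "(\<lambda>\<omega> j. X (j + h) \<omega>) \<in> borel_measurable M" for h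
    by (intro measurable_coordinatewise_then_product) measurable
  have [measurable]: "(\<lambda>\<omega> j. X j \<omega>) \<in> borel_measurable M"
    by (intro measurable_coordinatewise_then_product) measurable
  have [measurable]: "(\<lambda>(x :: int \<Rightarrow> 'v) j. inverse u *\<^sub>R x j) \<in> borel_measurable borel"
    by (rule borel_measurable_continuous_onI[OF continuous_on_scale_path])
  have "tail_integral (g \<circ> backshift_pow k) u
      = (\<integral>\<omega>. g (\<lambda>j. inverse u *\<^sub>R X (j + - k) \<omega>) \<partial>M)"
    unfolding tail_integral_def
  proof (intro Bochner_Integration.integral_cong refl)
    fix \<omega> assume \<omega>: "\<omega> \<in> space M"
    let ?x = "\<lambda>j. inverse u *\<^sub>R X (j + - k) \<omega>"
    have "\<omega> \<in> tail_event N M X u" if "?x \<in> exceedances t k"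
    proof -
      have "1 < N (X 0 \<omega>) / u"
        using that by (simp add: exceedances_def scl)
      then show ?thesis
        using \<omega> u by (simp add: tail_event_def field_simps)
    qed
    moreover have "backshift_pow k (\<lambda>j. inverse u *\<^sub>R X j \<omega>) = ?x"
      by (rule ext) (simp add: backshift_pow_apply)
    ultimately show "(g \<circ> backshift_pow k) (\<lambda>j. inverse u *\<^sub>R X j \<omega>)
        * indicator (tail_event N M X u) \<omega> = g ?x"
      using supp[of ?x] by (auto split: split_indicator)
  qed
  also have "\<dots> = (\<integral>x. g (\<lambda>j. inverse u *\<^sub>R x j) \<partial>distr M borel (\<lambda>\<omega> j. X (j + - k) \<omega>))"
    by (subst integral_distr) measurable
  also have "distr M borel (\<lambda>\<omega> j. X (j + - k) \<omega>) = distr M borel (\<lambda>\<omega> j. X j \<omega>)"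
    using stat unfolding stationary_def by blast
  also have "(\<integral>x. g (\<lambda>j. inverse u *\<^sub>R x j) \<partial>\<dots>) = (\<integral>\<omega>. g (\<lambda>j. inverse u *\<^sub>R X j \<omega>) \<partial>M)"
    by (subst integral_distr) measurable
  also have "\<dots> = tail_integral (\<lambda>x. g (\<lambda>j. t *\<^sub>R x j)) (t * u)"
    unfolding tail_integral_def
  proof (intro Bochner_Integration.integral_cong refl)
    fix \<omega> assume \<omega>: "\<omega> \<in> space M"
    let ?x = "\<lambda>j. inverse u *\<^sub>R X j \<omega>"
    have "\<omega> \<in> tail_event N M X (t * u)" if "?x \<in> exceedances t k"
    proof -
      have "t < N (X 0 \<omega>) / u"
        using that by (simp add: exceedances_def scl)
      then show ?thesis
        using \<omega> u by (simp add: tail_event_def field_simps)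
    qed
    moreover have "(\<lambda>j. t *\<^sub>R inverse (t * u) *\<^sub>R X j \<omega>) = ?x"
      using t by (simp add: field_simps)
    ultimately show "g ?x = g (\<lambda>j. t *\<^sub>R inverse (t * u) *\<^sub>R X j \<omega>)
        * indicator (tail_event N M X (t * u)) \<omega>"
      using supp[of ?x] by (auto split: split_indicator)
  qed
  finally show ?thesis .
qed

section \<open>Regular variation of the tail probabilities\<close>

text \<open>For a fixed test function \<open>h\<close> with \<open>E h(t Y) > 0\<close>, the time change with \<open>k = 0\<close> forces the
  ratio to converge to \<open>E h(Y) / E h(t Y)\<close>, which is therefore the same for all such \<open>h\<close>. Letting
  \<open>h\<close> approach the indicator of \<open>N (x 0) > m\<close> with \<open>m = max t 1\<close> evaluates this constant:
  the Pareto law applies to both expectations because \<open>m \<ge> 1\<close> and \<open>m / t \<ge> 1\<close>, and they are in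
  the limit \<open>m\<^sup>-\<^sup>\<alpha>\<close> and \<open>(m / t)\<^sup>-\<^sup>\<alpha>\<close>.\<close>

lemma tail_prob_ratio:
  assumes t: "t > 0"
  shows "((\<lambda>u. tail_prob (t * u) / tail_prob u) \<longlongrightarrow> t powr - \<alpha>) at_top"
proof -
  define m where "m = max t 1"
  define A :: "(int \<Rightarrow> 'v) set" where "A = exceedances t 0"
  have A_iff: "x \<in> A \<longleftrightarrow> N (x 0) > m" for x
    by (auto simp: A_def exceedances_def m_def)
  have A_open: "open A"
    unfolding A_def by (rule open_exceedances)
  then have A_sets [measurable]: "A \<in> sets borel" by simp
  from open_indicator_continuous_limit[OF A_open] obtain g :: "nat \<Rightarrow> (int \<Rightarrow> 'v) \<Rightarrow> real" where g:
    "\<And>n. continuous_on UNIV (g n)" "\<And>n x. 0 \<le> g n x" "\<And>n x. g n x \<le> 1"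
    "\<And>n x. x \<notin> A \<Longrightarrow> g n x = 0" "\<And>x. (\<lambda>n. g n x) \<longlonglongrightarrow> indicator A x"
    by blast
  \<comment> \<open>Membership in \<open>A\<close> depends on the coordinate at \<open>0\<close> only, so restricting the approximants to
    that coordinate spoils neither their support nor their limit.\<close>
  define h where "h n x = g n (truncation 0 x)" for n x
  have trunc_A: "truncation 0 x \<in> A \<longleftrightarrow> x \<in> A" for x
    by (simp add: A_iff truncation_def)
  have h_cont: "continuous_on UNIV (h n)" for n
    unfolding h_def by (rule continuous_on_compose2[OF g(1) continuous_on_truncation]) simp
  have h_meas [measurable]: "h n \<in> borel_measurable borel" for n
    by (rule borel_measurable_continuous_onI[OF h_cont])
  have h_bound: "\<bar>h n x\<bar> \<le> 1" for n x
    using g(2,3) by (simp add: h_def)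
  have h_supp: "h n x = 0" if "x \<notin> A" for n x
    using that g(4) by (simp add: h_def trunc_A)
  have h_lim: "(\<lambda>n. h n x) \<longlonglongrightarrow> indicator A x" for x
    using g(5)[of "truncation 0 x"] by (simp add: h_def trunc_A indicator_def)
  have h_expectation: "(\<lambda>n. \<integral>\<omega>. h n (\<lambda>j. c *\<^sub>R Y j \<omega>) \<partial>M') \<longlonglongrightarrow> (m / c) powr - \<alpha>"
    if c: "c > 0" "c \<le> m" for c
  proof -
    have "(\<lambda>n. \<integral>\<omega>. h n (\<lambda>j. c *\<^sub>R Y j \<omega>) \<partial>M')
        \<longlonglongrightarrow> (\<integral>\<omega>. indicator A (\<lambda>j. c *\<^sub>R Y j \<omega>) \<partial>M')"
      by (rule M'.expectation_tendsto_bounded[where C = 1]) (use h_lim h_bound in measurable)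
    also have "(\<integral>\<omega>. indicator A (\<lambda>j. c *\<^sub>R Y j \<omega>) \<partial>M')
        = (\<integral>\<omega>. indicator {\<omega> \<in> space M'. N (Y 0 \<omega>) > m / c} \<omega> \<partial>M')"
      using c by (intro Bochner_Integration.integral_cong)
        (auto simp: A_iff N_scale field_simps split: split_indicator)
    also have "\<dots> = (m / c) powr - \<alpha>"
      using Y_exceeds[of "m / c"] c by simp
    finally show ?thesis .
  qed
  define a where "a n = (\<integral>\<omega>. h n (\<lambda>j. Y j \<omega>) \<partial>M')" for n
  define b where "b n = (\<integral>\<omega>. h n (\<lambda>j. t *\<^sub>R Y j \<omega>) \<partial>M')" for n
  have a_lim: "a \<longlonglongrightarrow> m powr - \<alpha>"
    using h_expectation[of 1] by (simp add: a_def[abs_def] m_def)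
  have b_lim: "b \<longlonglongrightarrow> (m / t) powr - \<alpha>"
    using h_expectation[of t] t by (simp add: b_def[abs_def] m_def)
  have mt_pos: "(m / t) powr - \<alpha> > 0"
    using t by (simp add: m_def)
  have ratio: "((\<lambda>u. tail_prob (t * u) / tail_prob u) \<longlongrightarrow> a n / b n) at_top"
    if bn: "b n > 0" for n
  proof -
    define J where "J u = tail_integral (h n) u" for u
    have bdd: "bounded (range (h n))"
      using h_bound by (auto simp: bounded_iff)
    have trunc_idem: "truncation 0 (truncation 0 x) = truncation 0 x" for x :: "int \<Rightarrow> 'v"
      by (auto simp: truncation_def)
    have trunc_scale: "truncation 0 (\<lambda>j. t *\<^sub>R truncation 0 x j)
        = truncation 0 (\<lambda>j. t *\<^sub>R x j)" for x :: "int \<Rightarrow> 'v"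
      by (auto simp: truncation_def)
    have lim_a: "((\<lambda>u. J u / tail_prob u) \<longlongrightarrow> a n) at_top"
      unfolding a_def J_def
      by (rule tail_integral_limit[where m = 0, OF h_cont bdd]) (simp add: h_def trunc_idem)
    have "((\<lambda>u. tail_integral (\<lambda>x. h n (\<lambda>j. t *\<^sub>R x j)) u / tail_prob u) \<longlongrightarrow> b n) at_top"
      unfolding b_def
    proof (rule tail_integral_limit[where m = 0])
      show "continuous_on UNIV (\<lambda>x. h n (\<lambda>j. t *\<^sub>R x j))"
        by (rule continuous_on_compose2[OF h_cont continuous_on_scale_path]) simp
      show "bounded (range (\<lambda>x. h n (\<lambda>j. t *\<^sub>R x j)))"
        by (rule bounded_subset[OF bdd]) auto
    qed (simp add: h_def trunc_scale)
    then have "((\<lambda>u. tail_integral (\<lambda>x. h n (\<lambda>j. t *\<^sub>R x j)) (t * u) / tail_prob (t * u))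
        \<longlongrightarrow> b n) at_top"
      by (rule filterlim_compose)
        (use t in \<open>auto intro!: filterlim_tendsto_pos_mult_at_top[OF tendsto_const] filterlim_ident\<close>)
    moreover have "\<forall>\<^sub>F u in at_top. tail_integral (\<lambda>x. h n (\<lambda>j. t *\<^sub>R x j)) (t * u) = J u"
      using eventually_gt_at_top[of 0]
    proof eventually_elim
      case (elim u)
      have "h n \<circ> backshift_pow 0 = h n"
        by (simp add: fun_eq_iff backshift_pow_def)
      then show ?case
        using tail_integral_time_change[of "h n" t 0 u] h_supp elim t
        by (simp add: J_def A_def)
    qed
    ultimately have lim_b: "((\<lambda>u. J u / tail_prob (t * u)) \<longlongrightarrow> b n) at_top"
      by (elim Lim_transform_eventually) (auto elim: eventually_mono)
    have "((\<lambda>u. (J u / tail_prob u) / (J u / tail_prob (t * u))) \<longlongrightarrow> a n / b n) at_top"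
      using bn by (intro tendsto_divide lim_a lim_b) simp
    moreover have "\<forall>\<^sub>F u in at_top. (J u / tail_prob u) / (J u / tail_prob (t * u))
        = tail_prob (t * u) / tail_prob u"
      using order_tendstoD(1)[OF lim_b bn]
    proof eventually_elim
      case (elim u)
      then have "J u \<noteq> 0" by auto
      then show ?case by simp
    qed
    ultimately show ?thesis
      by (rule Lim_transform_eventually)
  qed
  have b_pos: "\<forall>\<^sub>F n in sequentially. b n > 0"
    using order_tendstoD(1)[OF b_lim mt_pos] .
  then obtain n0 where n0: "b n0 > 0"
    by (meson eventually_happens sequentially_bot)
  have "\<forall>\<^sub>F n in sequentially. a n / b n = a n0 / b n0"
    using b_pos
  proof eventually_elim
    case (elim n)
    show ?case
      by (rule tendsto_unique[OF _ ratio[OF elim] ratio[OF n0]]) simp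
  qed
  then have "(\<lambda>n. a n / b n) \<longlonglongrightarrow> a n0 / b n0"
    by (rule tendsto_eventually)
  moreover have "(\<lambda>n. a n / b n) \<longlonglongrightarrow> m powr - \<alpha> / (m / t) powr - \<alpha>"
    using mt_pos by (intro tendsto_divide a_lim b_lim) simp
  ultimately have "a n0 / b n0 = m powr - \<alpha> / (m / t) powr - \<alpha>"
    by (rule LIMSEQ_unique)
  also have "\<dots> = t powr - \<alpha>"
    using t by (simp add: powr_divide m_def)
  finally show ?thesis
    using ratio[OF n0] by simp
qed

section \<open>Time change for the tail process\<close>

lemma time_change_cylinder:
  fixes g :: "(int \<Rightarrow> 'v) \<Rightarrow> real"
  assumes g: "continuous_on UNIV g" and bdd: "bounded (range g)"
    and supp: "\<And>x. x \<notin> exceedances t k \<Longrightarrow> g x = 0"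
    and cyl: "\<And>x. g (truncation m x) = g x" and t: "t > 0"
  shows "(\<integral>\<omega>. g (backshift_pow k (\<lambda>j. Y j \<omega>)) \<partial>M')
       = t powr - \<alpha> * (\<integral>\<omega>. g (\<lambda>j. t *\<^sub>R Y j \<omega>) \<partial>M')"
proof -
  let ?s = "\<lambda>x. g (\<lambda>j. t *\<^sub>R x j)" and ?m = "m + nat \<bar>k\<bar>"
  \<comment> \<open>Shifting a window by \<open>k\<close> keeps it inside the symmetric window enlarged by \<open>\<bar>k\<bar>\<close>.\<close>
  have [measurable]: "g \<in> borel_measurable borel"
    by (rule borel_measurable_continuous_onI[OF g])
  have "g (backshift_pow k (truncation ?m x)) = g (backshift_pow k x)" for x
  proof -
    have "truncation m (backshift_pow k (truncation ?m x)) j = truncation m (backshift_pow k x) j"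
      for j
    proof -
      have "\<bar>j - k\<bar> \<le> int ?m" if "\<bar>j\<bar> \<le> int m"
        using that by linarith
      then show ?thesis
        by (simp add: truncation_def backshift_pow_apply)
    qed
    then have "truncation m (backshift_pow k (truncation ?m x)) = truncation m (backshift_pow k x)"
      by (rule ext)
    then show ?thesis
      using cyl by metis
  qed
  moreover have "continuous_on UNIV (g \<circ> backshift_pow k)"
    unfolding o_def by (rule continuous_on_compose2[OF g continuous_on_backshift_pow]) simp
  moreover have "bounded (range (g \<circ> backshift_pow k))"
    by (rule bounded_subset[OF bdd]) auto
  ultimately have lhs: "((\<lambda>u. tail_integral (g \<circ> backshift_pow k) u / tail_prob u)
      \<longlongrightarrow> (\<integral>\<omega>. g (backshift_pow k (\<lambda>j. Y j \<omega>)) \<partial>M')) at_top"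
    using tail_integral_limit[of "g \<circ> backshift_pow k" ?m] by simp
  have "?s (truncation m x) = ?s x" for x
  proof -
    have "truncation m (\<lambda>j. t *\<^sub>R truncation m x j) = truncation m (\<lambda>j. t *\<^sub>R x j)"
      by (auto simp: truncation_def)
    then show ?thesis
      using cyl by metis
  qed
  moreover have "continuous_on UNIV ?s"
    by (rule continuous_on_compose2[OF g continuous_on_scale_path]) simp
  moreover have "bounded (range ?s)"
    by (rule bounded_subset[OF bdd]) auto
  ultimately have "((\<lambda>u. tail_integral ?s u / tail_prob u)
      \<longlongrightarrow> (\<integral>\<omega>. g (\<lambda>j. t *\<^sub>R Y j \<omega>) \<partial>M')) at_top"
    using tail_integral_limit[of ?s m] by simp
  then have "((\<lambda>u. tail_integral ?s (t * u) / tail_prob (t * u))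
      \<longlongrightarrow> (\<integral>\<omega>. g (\<lambda>j. t *\<^sub>R Y j \<omega>) \<partial>M')) at_top"
    by (rule filterlim_compose)
      (use t in \<open>auto intro!: filterlim_tendsto_pos_mult_at_top[OF tendsto_const] filterlim_ident\<close>)
  from tendsto_mult[OF tail_prob_ratio[OF t] this]
  have rhs: "((\<lambda>u. tail_prob (t * u) / tail_prob u * (tail_integral ?s (t * u) / tail_prob (t * u)))
      \<longlongrightarrow> t powr - \<alpha> * (\<integral>\<omega>. g (\<lambda>j. t *\<^sub>R Y j \<omega>) \<partial>M')) at_top" .
  have "\<forall>\<^sub>F u in at_top. tail_prob (t * u) / tail_prob u * (tail_integral ?s (t * u) / tail_prob (t * u))
      = tail_integral (g \<circ> backshift_pow k) u / tail_prob u"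
    using eventually_gt_at_top[of 0]
  proof eventually_elim
    case (elim u)
    then show ?case
      using tail_integral_time_change[of g t k u] supp t tail_prob_pos[of "t * u"] by simp
  qed
  with rhs have "((\<lambda>u. tail_integral (g \<circ> backshift_pow k) u / tail_prob u)
      \<longlongrightarrow> t powr - \<alpha> * (\<integral>\<omega>. g (\<lambda>j. t *\<^sub>R Y j \<omega>) \<partial>M')) at_top"
    by (rule Lim_transform_eventually)
  then show ?thesis
    using tendsto_unique[OF _ lhs] by simp
qed

lemma backshift_Y_path_measurable [measurable]:
  "(\<lambda>\<omega>. backshift_pow k (\<lambda>j. Y j \<omega>)) \<in> borel_measurable M'"
  by (rule measurable_compose[OF Y_path_measurable'
        borel_measurable_continuous_onI[OF continuous_on_backshift_pow]])

lemma time_change_continuous: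
  fixes g :: "(int \<Rightarrow> 'v) \<Rightarrow> real"
  assumes g: "continuous_on UNIV g" and bdd: "bounded (range g)"
    and supp: "\<And>x. x \<notin> exceedances t k \<Longrightarrow> g x = 0" and t: "t > 0"
  shows "(\<integral>\<omega>. g (backshift_pow k (\<lambda>j. Y j \<omega>)) \<partial>M')
       = t powr - \<alpha> * (\<integral>\<omega>. g (\<lambda>j. t *\<^sub>R Y j \<omega>) \<partial>M')"
proof -
  \<comment> \<open>The windows contain \<open>0\<close> and \<open>k\<close>, so truncation preserves the support condition.\<close>
  define h where "h n x = g (truncation (n + nat \<bar>k\<bar>) x)" for n x
  have trunc_exceedances: "truncation (n + nat \<bar>k\<bar>) x \<in> exceedances t k \<longleftrightarrow> x \<in> exceedances t k"
    for n x by (simp add: exceedances_def truncation_def)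
  have trunc_idem: "truncation n (truncation n x) = truncation n x" for n and x :: "int \<Rightarrow> 'v"
    by (auto simp: truncation_def)
  obtain C where C: "\<And>x. \<bar>g x\<bar> \<le> C"
    using bdd by (auto simp: bounded_iff)
  have [measurable]: "g \<in> borel_measurable borel"
    by (rule borel_measurable_continuous_onI[OF g])
  have h_cont: "continuous_on UNIV (h n)" for n
    unfolding h_def by (rule continuous_on_compose2[OF g continuous_on_truncation]) simp
  have [measurable]: "h n \<in> borel_measurable borel" for n
    by (rule borel_measurable_continuous_onI[OF h_cont])
  have h_lim: "(\<lambda>n. h n x) \<longlonglongrightarrow> g x" for x
  proof -
    have "(\<lambda>n. truncation (n + nat \<bar>k\<bar>) x) \<longlonglongrightarrow> x"
      by (rule LIMSEQ_ignore_initial_segment[OF truncation_tendsto])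
    then show ?thesis
      unfolding h_def using continuous_on_tendsto_compose[OF g] by simp
  qed
  have h_bound: "\<bar>h n x\<bar> \<le> C" for n x
    by (simp add: h_def C)
  have lim: "(\<lambda>n. \<integral>\<omega>. h n (Z \<omega>) \<partial>M') \<longlonglongrightarrow> (\<integral>\<omega>. g (Z \<omega>) \<partial>M')"
    if [measurable]: "Z \<in> borel_measurable M'" for Z
    by (rule M'.expectation_tendsto_bounded[where C = C]) (use h_lim h_bound in measurable)
  have "(\<integral>\<omega>. h n (backshift_pow k (\<lambda>j. Y j \<omega>)) \<partial>M')
       = t powr - \<alpha> * (\<integral>\<omega>. h n (\<lambda>j. t *\<^sub>R Y j \<omega>) \<partial>M')" for n
  proof (rule time_change_cylinder[OF h_cont _ _ _ t])
    show "bounded (range (h n))"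
      using h_bound by (auto simp: bounded_iff)
    show "h n x = 0" if "x \<notin> exceedances t k" for x
      using that supp by (simp add: h_def trunc_exceedances)
    show "h n (truncation (n + nat \<bar>k\<bar>) x) = h n x" for x
      by (simp add: h_def trunc_idem)
  qed
  then have "(\<lambda>n. \<integral>\<omega>. h n (backshift_pow k (\<lambda>j. Y j \<omega>)) \<partial>M')
      \<longlonglongrightarrow> t powr - \<alpha> * (\<integral>\<omega>. g (\<lambda>j. t *\<^sub>R Y j \<omega>) \<partial>M')"
    using tendsto_mult_left[OF lim[of "\<lambda>\<omega> j. t *\<^sub>R Y j \<omega>"]] by simp
  then show ?thesis
    using LIMSEQ_unique[OF lim[of "\<lambda>\<omega>. backshift_pow k (\<lambda>j. Y j \<omega>)"]] by simp
qed

lemma time_change_open: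
  fixes A :: "(int \<Rightarrow> 'v) set"
  assumes A: "open A" and sub: "A \<subseteq> exceedances t k" and t: "t > 0"
  shows "measure M' {\<omega> \<in> space M'. backshift_pow k (\<lambda>j. Y j \<omega>) \<in> A}
       = t powr - \<alpha> * measure M' {\<omega> \<in> space M'. (\<lambda>j. t *\<^sub>R Y j \<omega>) \<in> A}"
proof -
  from open_indicator_continuous_limit[OF A] obtain g :: "nat \<Rightarrow> (int \<Rightarrow> 'v) \<Rightarrow> real" where g:
    "\<And>n. continuous_on UNIV (g n)" "\<And>n x. 0 \<le> g n x" "\<And>n x. g n x \<le> 1"
    "\<And>n x. x \<notin> A \<Longrightarrow> g n x = 0" "\<And>x. (\<lambda>n. g n x) \<longlonglongrightarrow> indicator A x"
    by blast
  have g_abs: "\<bar>g n x\<bar> \<le> 1" for n x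
    using g(2,3) by simp
  have [measurable]: "A \<in> sets borel" using A by simp
  have [measurable]: "g n \<in> borel_measurable borel" for n
    by (rule borel_measurable_continuous_onI[OF g(1)])
  have lim: "(\<lambda>n. \<integral>\<omega>. g n (Z \<omega>) \<partial>M') \<longlonglongrightarrow> measure M' {\<omega> \<in> space M'. Z \<omega> \<in> A}"
    if [measurable]: "Z \<in> borel_measurable M'" for Z
  proof -
    have "(\<lambda>n. \<integral>\<omega>. g n (Z \<omega>) \<partial>M') \<longlonglongrightarrow> (\<integral>\<omega>. indicator A (Z \<omega>) \<partial>M')"
      by (rule M'.expectation_tendsto_bounded[where C = 1]) (use g(5) g_abs in measurable)
    also have "(\<integral>\<omega>. indicator A (Z \<omega>) \<partial>M')
        = (\<integral>\<omega>. indicator {\<omega> \<in> space M'. Z \<omega> \<in> A} \<omega> \<partial>M')"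
      by (intro Bochner_Integration.integral_cong) (auto split: split_indicator)
    finally show ?thesis by simp
  qed
  have "(\<integral>\<omega>. g n (backshift_pow k (\<lambda>j. Y j \<omega>)) \<partial>M')
       = t powr - \<alpha> * (\<integral>\<omega>. g n (\<lambda>j. t *\<^sub>R Y j \<omega>) \<partial>M')" for n
  proof (rule time_change_continuous[OF g(1) _ _ t])
    show "bounded (range (g n))"
      using g_abs by (auto simp: bounded_iff)
    show "g n x = 0" if "x \<notin> exceedances t k" for x
      using that sub g(4) by blast
  qed
  then have "(\<lambda>n. \<integral>\<omega>. g n (backshift_pow k (\<lambda>j. Y j \<omega>)) \<partial>M')
      \<longlonglongrightarrow> t powr - \<alpha> * measure M' {\<omega> \<in> space M'. (\<lambda>j. t *\<^sub>R Y j \<omega>) \<in> A}"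
    using tendsto_mult_left[OF lim[of "\<lambda>\<omega> j. t *\<^sub>R Y j \<omega>"]] by simp
  then show ?thesis
    using LIMSEQ_unique[OF lim[of "\<lambda>\<omega>. backshift_pow k (\<lambda>j. Y j \<omega>)"]] by simp
qed

lemma time_change_law:
  fixes t :: real and k :: int
  assumes t: "t > 0"
  defines "K \<equiv> exceedances t k"
  shows "density (distr M' borel (\<lambda>\<omega>. backshift_pow k (\<lambda>j. Y j \<omega>))) (indicator K)
       = scale_measure (t powr - \<alpha>)
           (density (distr M' borel (\<lambda>\<omega> j. t *\<^sub>R Y j \<omega>)) (indicator K))" (is "?P = ?Q")
proof -
  have K_open: "open K"
    unfolding K_def by (rule open_exceedances)
  then have [measurable]: "K \<in> sets borel" by simp
  have restricted: "emeasure (density (distr M' borel Z) (indicator K)) A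
      = ennreal (measure M' {\<omega> \<in> space M'. Z \<omega> \<in> A \<inter> K})"
    if [measurable]: "Z \<in> borel_measurable M'" and "open A" for Z and A :: "(int \<Rightarrow> 'v) set"
  proof -
    have [measurable]: "A \<in> sets borel" using \<open>open A\<close> by simp
    have "emeasure (density (distr M' borel Z) (indicator K)) A
        = emeasure (distr M' borel Z) (K \<inter> A)"
      by (simp add: emeasure_density nn_integral_indicator flip: indicator_inter_arith)
    also have "\<dots> = emeasure M' {\<omega> \<in> space M'. Z \<omega> \<in> A \<inter> K}"
      by (subst emeasure_distr) (auto intro!: arg_cong[where f="emeasure M'"])
    finally show ?thesis
      by (simp add: M'.emeasure_eq_measure)
  qed
  show ?thesis
  proof (rule measure_eqI_generator_eq[where E = "{S. open S}" and \<Omega> = UNIV and A = "\<lambda>_. UNIV"])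
    show "Int_stable {S :: (int \<Rightarrow> 'v) set. open S}"
      by (auto simp: Int_stable_def)
    fix A :: "(int \<Rightarrow> 'v) set" assume "A \<in> {S. open S}"
    then have A: "open A" by simp
    show "emeasure ?P A = emeasure ?Q A"
      using time_change_open[OF open_Int[OF A K_open] _ t, of k]
      by (simp add: restricted A ennreal_mult) (simp add: K_def ennreal_mult)
  next
    show "sets ?P = sigma_sets UNIV {S. open S}" "sets ?Q = sigma_sets UNIV {S. open S}"
      by (simp_all add: borel_def)
    show "emeasure ?P UNIV \<noteq> \<infinity>"
      by (subst restricted) auto
  qed auto
qed

end

theorem lemma2p2:
  fixes N :: "real ^ 'd \<Rightarrow> real"
    and M :: "'a measure" and X :: "int \<Rightarrow> 'a \<Rightarrow> real ^ 'd"
    and M' :: "'b measure" and Y :: "int \<Rightarrow> 'b \<Rightarrow> real ^ 'd"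
    and \<alpha> t :: real and k :: int
    and H :: "(int \<Rightarrow> real ^ 'd) \<Rightarrow> ennreal"
  assumes "is_norm N"
    and "prob_space M" and "\<And>j. X j \<in> borel_measurable M"
    and "stationary M X"
    and "regularly_varying N M X" and "tail_index N M X \<alpha>"
    and "tail_process N M X \<alpha> M' Y"
    and "H \<in> borel_measurable borel"
    and "t > 0"
  shows "(\<integral>\<^sup>+\<omega>. H (backshift_pow k (\<lambda>j. Y j \<omega>)) * indicator {\<omega>. N (Y (- k) \<omega>) > t} \<omega> \<partial>M')
    = ennreal (t powr - \<alpha>) *
      (\<integral>\<^sup>+\<omega>. H (\<lambda>j. t *\<^sub>R Y j \<omega>) * indicator {\<omega>. N (Y k \<omega>) > 1 / t} \<omega> \<partial>M')"
proof -
  interpret stationary_tail_process N M X M' Y \<alpha>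
    by (rule stationary_tail_process.intro) (fact assms)+
  note [measurable] = \<open>H \<in> borel_measurable borel\<close>
  let ?K = "exceedances t k"
  \<comment> \<open>Almost surely \<open>N (Y 0) > 1\<close>, so on each side the indicator in the claim agrees with that of
    \<open>?K\<close> at the respective path.\<close>
  have [measurable]: "?K \<in> sets borel"
    using open_exceedances by simp
  have "(\<integral>\<^sup>+\<omega>. H (backshift_pow k (\<lambda>j. Y j \<omega>)) * indicator {\<omega>. N (Y (- k) \<omega>) > t} \<omega> \<partial>M')
      = (\<integral>\<^sup>+\<omega>. indicator ?K (backshift_pow k (\<lambda>j. Y j \<omega>)) * H (backshift_pow k (\<lambda>j. Y j \<omega>)) \<partial>M')"
    using AE_Y_exceeds
    by (intro nn_integral_cong_AE, eventually_elim)
      (auto simp: exceedances_def backshift_pow_apply split: split_indicator)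
  also have "\<dots> = (\<integral>\<^sup>+x. H x \<partial>density (distr M' borel (\<lambda>\<omega>. backshift_pow k (\<lambda>j. Y j \<omega>))) (indicator ?K))"
    by (simp add: nn_integral_density nn_integral_distr)
  also have "\<dots> = ennreal (t powr - \<alpha>) *
      (\<integral>\<^sup>+\<omega>. indicator ?K (\<lambda>j. t *\<^sub>R Y j \<omega>) * H (\<lambda>j. t *\<^sub>R Y j \<omega>) \<partial>M')"
    unfolding time_change_law[OF \<open>t > 0\<close>]
    by (simp add: nn_integral_scale_measure nn_integral_density nn_integral_distr)
  also have "(\<integral>\<^sup>+\<omega>. indicator ?K (\<lambda>j. t *\<^sub>R Y j \<omega>) * H (\<lambda>j. t *\<^sub>R Y j \<omega>) \<partial>M')
      = (\<integral>\<^sup>+\<omega>. H (\<lambda>j. t *\<^sub>R Y j \<omega>) * indicator {\<omega>. N (Y k \<omega>) > 1 / t} \<omega> \<partial>M')"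
    using AE_Y_exceeds
  proof (intro nn_integral_cong_AE, eventually_elim)
    case (elim \<omega>)
    have "t * N (Y k \<omega>) > 1 \<longleftrightarrow> N (Y k \<omega>) > 1 / t"
      using \<open>t > 0\<close> by (simp add: field_simps)
    then show ?case
      using elim \<open>t > 0\<close> by (auto simp: exceedances_def N_scale split: split_indicator)
  qed
  finally show ?thesis .
qed

end
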